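(* Let $\mathcal{W}$ be the planar Galilean conformal algebra over $\mathbb{C}$. For every $\frac{1}{2}$-derivation $\varphi$ of $\mathcal{W}$ there exists $a\in\mathbb{C}$ such that $\varphi(x)=a x$ for all $x\in\mathcal{W}$.
   Context: All vector spaces are over $\mathbb{C}$. The planar Galilean conformal algebra $\mathcal{W}$ is the infinite-dimensional complex Lie algebra with basis $\{L_m, H_m, I_m, J_m \mid m\in\mathbb{Z}\}$ and Lie bracket determined, by bilinearity and skew-symmetry, by the following relations for all $m,n\in\mathbb{Z}$ (all other brackets of basis elements are zero): $[L_m,L_n]=(m-n)L_{m+n}$, $[L_m,H_n]=-nH_{m+n}$, $[L_m,I_n]=(m-n)I_{m+n}$, $[L_m,J_n]=(m-n)J_{m+n}$, $[H_m,I_n]=J_{m+n}$, $[H_m,J_n]=-I_{m+n}$. A $\frac{1}{2}$-derivation of a Lie algebra $(L,[\cdot,\cdot])$ is a linear map $\varphi:L\to L$ such that $\varphi([x,y])=\frac{1}{2}\big([\varphi(x),y]+[x,\varphi(y)]\big)$ for all $x,y\in L$. *)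

theory Defs
  imports Complex_Main "HOL-Library.Poly_Mapping"
begin

locale complex_lie_algebra = vector_space scale
  for scale :: "complex \<Rightarrow> 'v \<Rightarrow> 'v::ab_group_add" +
  fixes bracket :: "'v \<Rightarrow> 'v \<Rightarrow> 'v"
  assumes bracket_add_left: "bracket (x + y) z = bracket x z + bracket y z"
    and bracket_add_right: "bracket x (y + z) = bracket x y + bracket x z"
    and bracket_scale_left: "bracket (scale c x) y = scale c (bracket x y)"
    and bracket_scale_right: "bracket x (scale c y) = scale c (bracket x y)"
    and bracket_self: "bracket x x = 0"
    and jacobi: "bracket x (bracket y z) + bracket y (bracket z x) + bracket z (bracket x y) = 0"

definition half_derivation ::
    "(complex \<Rightarrow> 'v \<Rightarrow> 'v) \<Rightarrow> ('v \<Rightarrow> 'v \<Rightarrow> 'v) \<Rightarrow> ('v::ab_group_add \<Rightarrow> 'v) \<Rightarrow> bool" where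
  "half_derivation scale bracket \<phi> \<longleftrightarrow>
     Vector_Spaces.linear scale scale \<phi> \<and>
     (\<forall>x y. \<phi> (bracket x y) = scale (1/2) (bracket (\<phi> x) y + bracket x (\<phi> y)))"

datatype gca_index = GL int | GH int | GI int | GJ int

text \<open>
  The underlying space is the free complex vector space on the index type: finitely supported
  coefficient functions, with basis vectors \<open>single (GL m) 1\<close>, \<open>single (GH m) 1\<close>, and so on.
\<close>

type_synonym gca = "gca_index \<Rightarrow>\<^sub>0 complex"

definition gca_scale :: "complex \<Rightarrow> gca \<Rightarrow> gca" where
  "gca_scale c x = Poly_Mapping.map ((*) c) x"

text \<open>
  Structure constants. The equations with first index \<open>GI\<close> or \<open>GJ\<close> (and those for \<open>GH\<close> against
  \<open>GL\<close>) are the ones forced by skew-symmetry.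
\<close>

fun gca_basis_bracket :: "gca_index \<Rightarrow> gca_index \<Rightarrow> gca" where
  "gca_basis_bracket (GL m) (GL n) = Poly_Mapping.single (GL (m + n)) (of_int (m - n))"
| "gca_basis_bracket (GL m) (GH n) = Poly_Mapping.single (GH (m + n)) (of_int (- n))"
| "gca_basis_bracket (GL m) (GI n) = Poly_Mapping.single (GI (m + n)) (of_int (m - n))"
| "gca_basis_bracket (GL m) (GJ n) = Poly_Mapping.single (GJ (m + n)) (of_int (m - n))"
| "gca_basis_bracket (GH m) (GI n) = Poly_Mapping.single (GJ (m + n)) 1"
| "gca_basis_bracket (GH m) (GJ n) = Poly_Mapping.single (GI (m + n)) (- 1)"
| "gca_basis_bracket (GH m) (GL n) = Poly_Mapping.single (GH (m + n)) (of_int m)"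
| "gca_basis_bracket (GI m) (GL n) = Poly_Mapping.single (GI (m + n)) (of_int (m - n))"
| "gca_basis_bracket (GJ m) (GL n) = Poly_Mapping.single (GJ (m + n)) (of_int (m - n))"
| "gca_basis_bracket (GI m) (GH n) = Poly_Mapping.single (GJ (m + n)) (- 1)"
| "gca_basis_bracket (GJ m) (GH n) = Poly_Mapping.single (GI (m + n)) 1"
| "gca_basis_bracket _ _ = 0"

definition gca_bracket :: "gca \<Rightarrow> gca \<Rightarrow> gca" where
  "gca_bracket x y =
     (\<Sum>i\<in>Poly_Mapping.keys x. \<Sum>j\<in>Poly_Mapping.keys y.
        gca_scale (Poly_Mapping.lookup x i * Poly_Mapping.lookup y j) (gca_basis_bracket i j))"

lemma lookup_gca_scale [simp]:
  "Poly_Mapping.lookup (gca_scale c x) i = c * Poly_Mapping.lookup x i"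
  by (simp add: gca_scale_def Poly_Mapping.map.rep_eq when_def)

lemma gca_scale_single [simp]:
  "gca_scale c (Poly_Mapping.single i d) = Poly_Mapping.single i (c * d)"
  by (rule poly_mapping_eqI) (simp add: lookup_single when_def)

interpretation gca: vector_space gca_scale
  by unfold_locales (auto intro!: poly_mapping_eqI simp: lookup_add algebra_simps)

lemma gca_bracket_sum:
  assumes "finite S" "finite T" "Poly_Mapping.keys x \<subseteq> S" "Poly_Mapping.keys y \<subseteq> T"
  shows "gca_bracket x y =
     (\<Sum>i\<in>S. \<Sum>j\<in>T. gca_scale (Poly_Mapping.lookup x i * Poly_Mapping.lookup y j)
        (gca_basis_bracket i j))"
proof -
  have "gca_bracket x y = (\<Sum>i\<in>Poly_Mapping.keys x. \<Sum>j\<in>T.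
      gca_scale (Poly_Mapping.lookup x i * Poly_Mapping.lookup y j) (gca_basis_bracket i j))"
    unfolding gca_bracket_def
    by (intro sum.cong refl sum.mono_neutral_left) (use assms in \<open>auto simp: in_keys_iff\<close>)
  also have "\<dots> = (\<Sum>i\<in>S. \<Sum>j\<in>T.
      gca_scale (Poly_Mapping.lookup x i * Poly_Mapping.lookup y j) (gca_basis_bracket i j))"
    by (intro sum.mono_neutral_left) (use assms in \<open>auto simp: in_keys_iff\<close>)
  finally show ?thesis .
qed

lemma gca_bracket_add_left: "gca_bracket (x + y) z = gca_bracket x z + gca_bracket y z"
proof -
  let ?S = "Poly_Mapping.keys x \<union> Poly_Mapping.keys y"
  have k: "Poly_Mapping.keys (x + y) \<subseteq> ?S" by (rule keys_add)
  show ?thesis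
    by (simp add: gca_bracket_sum[of ?S "Poly_Mapping.keys z"] k lookup_add
        sum.distrib gca.scale_left_distrib distrib_right)
qed

lemma gca_basis_bracket_skew: "gca_basis_bracket j i = - gca_basis_bracket i j"
  by (cases i; cases j) (simp_all add: add.commute flip: single_uminus)

lemma gca_bracket_skew: "gca_bracket y x = - gca_bracket x y"
proof -
  have "gca_bracket y x = (\<Sum>i\<in>Poly_Mapping.keys x. \<Sum>j\<in>Poly_Mapping.keys y.
      gca_scale (Poly_Mapping.lookup y j * Poly_Mapping.lookup x i) (gca_basis_bracket j i))"
    unfolding gca_bracket_def by (rule sum.swap)
  also have "\<dots> = (\<Sum>i\<in>Poly_Mapping.keys x. \<Sum>j\<in>Poly_Mapping.keys y.
      gca_scale (Poly_Mapping.lookup x i * Poly_Mapping.lookup y j) (- gca_basis_bracket i j))"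
    by (intro sum.cong refl arg_cong2[of _ _ _ _ gca_scale] gca_basis_bracket_skew mult.commute)
  also have "\<dots> = - gca_bracket x y"
    unfolding gca_bracket_def by (simp add: sum_negf gca.scale_minus_right)
  finally show ?thesis .
qed

lemma gca_bracket_add_right: "gca_bracket x (y + z) = gca_bracket x y + gca_bracket x z"
  by (metis gca_bracket_skew gca_bracket_add_left minus_add_distrib)

lemma gca_bracket_scale_left: "gca_bracket (gca_scale c x) y = gca_scale c (gca_bracket x y)"
proof -
  have k: "Poly_Mapping.keys (gca_scale c x) \<subseteq> Poly_Mapping.keys x"
    by (auto simp: in_keys_iff)
  show ?thesis
    by (simp add: gca_bracket_sum[of "Poly_Mapping.keys x" "Poly_Mapping.keys y"] k
        gca.scale_sum_right mult.assoc)
qed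

lemma gca_bracket_scale_right: "gca_bracket x (gca_scale c y) = gca_scale c (gca_bracket x y)"
  by (metis gca_bracket_skew gca_bracket_scale_left gca.scale_minus_right)

lemma gca_bracket_self: "gca_bracket x x = 0"
proof (rule poly_mapping_eqI)
  fix i
  have "Poly_Mapping.lookup (gca_bracket x x) i = - Poly_Mapping.lookup (gca_bracket x x) i"
    using arg_cong[OF gca_bracket_skew[of x x], of "\<lambda>p. Poly_Mapping.lookup p i"] by simp
  then show "Poly_Mapping.lookup (gca_bracket x x) i = Poly_Mapping.lookup 0 i"
    by simp
qed

lemma gca_bracket_single [simp]:
  "gca_bracket (Poly_Mapping.single i a) (Poly_Mapping.single j b) =
     gca_scale (a * b) (gca_basis_bracket i j)"
  by (simp add: gca_bracket_sum[of "{i}" "{j}"])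

lemma gca_bracket_zero [simp]: "gca_bracket 0 x = 0" "gca_bracket x 0 = 0"
  by (simp_all add: gca_bracket_def)

lemma gca_induct [case_names zero single add]:
  fixes x :: gca
  assumes "P 0" "\<And>i a. P (Poly_Mapping.single i a)" "\<And>x y. P x \<Longrightarrow> P y \<Longrightarrow> P (x + y)"
  shows "P x"
proof -
  have "P (\<Sum>i\<in>S. Poly_Mapping.single i (Poly_Mapping.lookup x i))" if "finite S" for S
    using that by (induction S) (auto intro: assms)
  moreover have "(\<Sum>i\<in>Poly_Mapping.keys x. Poly_Mapping.single i (Poly_Mapping.lookup x i)) = x"
    by (rule poly_mapping_eqI) (auto simp: lookup_sum lookup_single when_def in_keys_iff)
  ultimately show ?thesis
    by (metis finite_keys)
qed

definition gca_jacobiator :: "gca \<Rightarrow> gca \<Rightarrow> gca \<Rightarrow> gca" where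
  "gca_jacobiator x y z = gca_bracket x (gca_bracket y z) + gca_bracket y (gca_bracket z x)
    + gca_bracket z (gca_bracket x y)"

lemma gca_jacobiator_single:
  "gca_jacobiator (Poly_Mapping.single i a) (Poly_Mapping.single j b) (Poly_Mapping.single k c) = 0"
  unfolding gca_jacobiator_def
  by (cases i; cases j; cases k; intro poly_mapping_eqI)
    (auto simp: lookup_add lookup_single when_def algebra_simps)

lemma gca_jacobiator_add:
  "gca_jacobiator (x + x') y z = gca_jacobiator x y z + gca_jacobiator x' y z"
  "gca_jacobiator x (y + y') z = gca_jacobiator x y z + gca_jacobiator x y' z"
  "gca_jacobiator x y (z + z') = gca_jacobiator x y z + gca_jacobiator x y z'"
  by (simp_all add: gca_jacobiator_def gca_bracket_add_left gca_bracket_add_right ac_simps)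

lemma gca_jacobiator_zero:
  "gca_jacobiator 0 y z = 0" "gca_jacobiator x 0 z = 0" "gca_jacobiator x y 0 = 0"
  by (simp_all add: gca_jacobiator_def)

lemma gca_jacobiator_eq_0: "gca_jacobiator x y z = 0"
proof (induction x rule: gca_induct)
  case (single i a)
  show ?case
  proof (induction y rule: gca_induct)
    case (single j b)
    show ?case
      by (induction z rule: gca_induct)
        (simp_all add: gca_jacobiator_zero gca_jacobiator_add gca_jacobiator_single)
  qed (simp_all add: gca_jacobiator_zero gca_jacobiator_add)
qed (simp_all add: gca_jacobiator_zero gca_jacobiator_add)

interpretation gca: complex_lie_algebra gca_scale gca_bracket
  by unfold_locales
    (rule gca_bracket_add_left gca_bracket_add_right gca_bracket_scale_left
      gca_bracket_scale_right gca_bracket_self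
      gca_jacobiator_eq_0[unfolded gca_jacobiator_def])+

end

theory Submission
  imports Defs
begin

text \<open>
  The multiples of the identity are half-derivations, so subtracting a suitable one from \<open>\<phi>\<close>
  gives a half-derivation \<open>\<psi>\<close> for which the coefficient of \<open>L\<^sub>0\<close> in \<open>\<psi>(L\<^sub>0)\<close> is zero; the claim is
  that \<open>\<psi> = 0\<close>.

  The algebra is \<open>\<int>\<close>-graded, and the coefficients of \<open>\<psi>(X\<^sub>n)\<close> at \<open>Y\<^bsub>n+d\<^esub>\<close>, for a fixed shift \<open>d\<close> and
  fixed families \<open>X\<close>, \<open>Y\<close> among \<open>L, H, I, J\<close>, form a function of \<open>n\<close> that is tested against brackets
  with the \<open>L\<^sub>m\<close>. All four families have the form \<open>[L\<^sub>m, X\<^sub>n] = (\<kappa>m - n) X\<^bsub>m+n\<^esub>\<close> with \<open>\<kappa>\<close> equal to \<open>0\<close>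
  (for \<open>H\<close>) or \<open>1\<close> (for \<open>L, I, J\<close>), so the resulting recurrences are those of
  \<open>witt_recurrence_eq_0\<close> (for \<open>X = L\<close>) and \<open>module_recurrence_eq_0\<close> (for the other families, once
  \<open>\<psi>\<close> vanishes on every \<open>L\<^sub>m\<close>).

  The relations among the \<open>L\<^sub>m\<close> alone leave, for every \<open>d\<close>, the maps \<open>L\<^sub>m \<mapsto> \<alpha> L\<^bsub>m+d\<^esub> + \<gamma> I\<^bsub>m+d\<^esub> + \<epsilon> J\<^bsub>m+d\<^esub>\<close>
  possible: the Witt algebra does have such non-scalar half-derivations. It is the bracket with
  \<open>H\<close> that excludes them. From \<open>[L\<^sub>m, H\<^sub>0] = 0\<close> one gets that \<open>\<gamma>\<close> and \<open>\<epsilon>\<close> are, up to sign,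
  \<open>m - d\<close> times a number independent of \<open>m\<close>, hence zero, as \<open>m = d\<close> shows; and comparing coefficients at \<open>H\<^bsub>2d\<^esub>\<close>
  in \<open>[L\<^sub>0, H\<^sub>d] = - d H\<^sub>d\<close> gives \<open>d \<alpha> = 0\<close>.
\<close>

section \<open>Two recurrences on the integers\<close>

text \<open>
  The value at \<open>d\<close> escapes the instance \<open>n = 0\<close>, and is recovered by writing \<open>d = 2d + (-d)\<close>.
\<close>

lemma witt_recurrence_eq_0:
  fixes f :: "int \<Rightarrow> complex" and d \<mu> :: int
  assumes rec: "\<And>m n. 2 * of_int (m - n) * f (m + n)
      = of_int (d + m - \<mu> * n) * f m + of_int (\<mu> * m - n - d) * f n"
    and "f 0 = 0"
  shows "f m = 0"
proof -
  have off: "f m = 0" if "m \<noteq> d" for m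
  proof -
    have "of_int (m - d) * f m = 0"
      using rec[of m 0] \<open>f 0 = 0\<close> by (simp add: algebra_simps)
    with that show ?thesis by simp
  qed
  have "f d = 0"
  proof (cases "d = 0")
    case False
    then show ?thesis
      using rec[of "2 * d" "- d"] off[of "2 * d"] off[of "- d"] by simp
  qed (simp add: \<open>f 0 = 0\<close>)
  with off show ?thesis by metis
qed

text \<open>
  The instance \<open>m = 0\<close> compares degrees and leaves only \<open>f d\<close>, which is then related to
  values already known to vanish: from \<open>n = d\<close> when the factor \<open>\<mu> m - 2 d\<close> can be made nonzero with
  \<open>m \<noteq> 0\<close>, and from \<open>m + n = 0\<close> otherwise.
\<close>

lemma module_recurrence_eq_0:
  fixes f :: "int \<Rightarrow> complex" and d \<kappa> \<mu> :: int
  assumes rec: "\<And>m n. 2 * of_int (\<kappa> * m - n) * f (m + n) = of_int (\<mu> * m - n - d) * f n"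
    and "0 \<le> \<kappa>"
  shows "f n = 0"
proof -
  have off: "f n = 0" if "n \<noteq> d" for n
  proof -
    have "of_int (n - d) * f n = 0"
      using rec[of 0 n] by (auto simp: algebra_simps)
    with that show ?thesis by simp
  qed
  have "f d = 0"
  proof (cases "d = 0 \<and> \<mu> = 0")
    case True
    have "of_int (2 * \<kappa> + 2) * f 0 = 0"
      using rec[of 1 "- 1"] off[of "- 1"] True by simp
    with True \<open>0 \<le> \<kappa>\<close> show ?thesis
      unfolding mult_eq_0_iff of_int_eq_0_iff by simp
  next
    case False
    obtain m where m: "m \<noteq> 0" "\<mu> * m - d - d \<noteq> 0"
    proof (cases "\<mu> - d - d = 0")
      case True
      then show ?thesis using False by (intro that[of 2]) auto
    qed (use that[of 1] in simp)
    have "of_int (\<mu> * m - d - d) * f d = 0"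
      using rec[of m d] off[of "m + d"] m by simp
    with m(2) show ?thesis
      unfolding mult_eq_0_iff of_int_eq_0_iff by simp
  qed
  with off show ?thesis by metis
qed

section \<open>Half-derivations and bracket coefficients\<close>

lemma (in complex_lie_algebra) half_derivation_minus_scale:
  assumes "half_derivation scale bracket \<phi>"
  shows "half_derivation scale bracket (\<lambda>x. \<phi> x - scale a x)"
proof -
  interpret p: vector_space_pair scale scale by unfold_locales
  have lin: "Vector_Spaces.linear scale scale \<phi>"
    and der: "\<And>x y. \<phi> (bracket x y) = scale (1/2) (bracket (\<phi> x) y + bracket x (\<phi> y))"
    using assms by (auto simp: half_derivation_def)
  have diff: "bracket (x - y) z = bracket x z - bracket y z"
      "bracket z (x - y) = bracket z x - bracket z y" for x y z
    using bracket_add_left[of "x - y" y z] bracket_add_right[of z "x - y" y] by simp_all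
  have half: "scale a z = scale (1/2) (scale a z + scale a z)" for z
    by (simp flip: scale_left_distrib add: scale_scale)
  have "Vector_Spaces.linear scale scale (\<lambda>x. \<phi> x - scale a x)"
    by (intro p.linear_compose_sub lin linear_scale_self)
  moreover have "\<phi> (bracket x y) - scale a (bracket x y)
      = scale (1/2) (bracket (\<phi> x - scale a x) y + bracket x (\<phi> y - scale a y))" for x y
    by (subst half[of "bracket x y"])
      (simp add: der diff bracket_scale_left bracket_scale_right
        flip: scale_right_diff_distrib)
  ultimately show ?thesis
    by (simp add: half_derivation_def)
qed

abbreviation basis :: "gca_index \<Rightarrow> gca" where
  "basis i \<equiv> Poly_Mapping.single i 1"

lemma lookup_bracket_L:
  "Poly_Mapping.lookup (gca_bracket (basis (GL m)) y) (GL k)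
     = of_int (2 * m - k) * Poly_Mapping.lookup y (GL (k - m))"
  "Poly_Mapping.lookup (gca_bracket (basis (GL m)) y) (GH k)
     = of_int (m - k) * Poly_Mapping.lookup y (GH (k - m))"
  "Poly_Mapping.lookup (gca_bracket (basis (GL m)) y) (GI k)
     = of_int (2 * m - k) * Poly_Mapping.lookup y (GI (k - m))"
  "Poly_Mapping.lookup (gca_bracket (basis (GL m)) y) (GJ k)
     = of_int (2 * m - k) * Poly_Mapping.lookup y (GJ (k - m))"
proof (induction y rule: gca_induct)
  case (single i a)
  {
    case 1 show ?case by (cases i) (auto simp: lookup_single when_def)
  next
    case 2 show ?case by (cases i) (auto simp: lookup_single when_def)
  next
    case 3 show ?case by (cases i) (auto simp: lookup_single when_def)
  next
    case 4 show ?case by (cases i) (auto simp: lookup_single when_def)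
  }
qed (simp_all add: gca_bracket_add_right lookup_add distrib_left)

lemma lookup_bracket_H_right:
  "Poly_Mapping.lookup (gca_bracket x (basis (GH n))) (GH k)
     = - of_int n * Poly_Mapping.lookup x (GL (k - n))"
  "Poly_Mapping.lookup (gca_bracket x (basis (GH n))) (GI k)
     = Poly_Mapping.lookup x (GJ (k - n))"
  "Poly_Mapping.lookup (gca_bracket x (basis (GH n))) (GJ k)
     = - Poly_Mapping.lookup x (GI (k - n))"
proof (induction x rule: gca_induct)
  case (single i a)
  {
    case 1 show ?case by (cases i) (auto simp: lookup_single when_def)
  next
    case 2 show ?case by (cases i) (auto simp: lookup_single when_def)
  next
    case 3 show ?case by (cases i) (auto simp: lookup_single when_def)
  }
qed (simp_all add: gca_bracket_add_left lookup_add distrib_left)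

lemma half_derivation_lookup:
  assumes "half_derivation gca_scale gca_bracket \<psi>"
    and "gca_bracket x y = gca_scale c z"
  shows "2 * c * Poly_Mapping.lookup (\<psi> z) i
    = Poly_Mapping.lookup (gca_bracket (\<psi> x) y) i
      + Poly_Mapping.lookup (gca_bracket x (\<psi> y)) i"
proof -
  interpret \<psi>: Vector_Spaces.linear gca_scale gca_scale \<psi>
    using assms(1) by (simp add: half_derivation_def)
  have "gca_scale c (\<psi> z) = \<psi> (gca_scale c z)"
    by (simp add: \<psi>.scale)
  also have "\<dots> = gca_scale (1/2) (gca_bracket (\<psi> x) y + gca_bracket x (\<psi> y))"
    using assms unfolding half_derivation_def by metis
  finally have "Poly_Mapping.lookup (gca_scale c (\<psi> z)) i
      = Poly_Mapping.lookup (gca_scale (1/2) (gca_bracket (\<psi> x) y + gca_bracket x (\<psi> y))) i"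
    by simp
  then show ?thesis by (simp add: lookup_add field_simps)
qed

section \<open>Vanishing of the normalised half-derivation\<close>

text \<open>
  Once \<open>\<psi>\<close> kills every \<open>L\<^sub>m\<close>, its restriction to a family \<open>X\<close> satisfies
  \<open>2 \<psi>([L\<^sub>m, X\<^sub>n]) = [L\<^sub>m, \<psi>(X\<^sub>n)]\<close>; the factor \<open>2\<close> keeps a nonzero map from intertwining the
  action of the \<open>L\<^sub>m\<close> in this way.
\<close>

lemma half_derivation_family_eq_0:
  fixes X :: "int \<Rightarrow> gca_index" and \<kappa> :: int
  assumes der: "half_derivation gca_scale gca_bracket \<psi>"
    and L: "\<And>m. \<psi> (basis (GL m)) = 0"
    and X: "\<And>m n. gca_bracket (basis (GL m)) (basis (X n))
        = gca_scale (of_int (\<kappa> * m - n)) (basis (X (m + n)))"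
    and "0 \<le> \<kappa>"
  shows "\<psi> (basis (X n)) = 0"
proof (rule poly_mapping_eqI)
  fix i
  have rec: "2 * of_int (\<kappa> * m - n) * Poly_Mapping.lookup (\<psi> (basis (X (m + n)))) i
      = Poly_Mapping.lookup (gca_bracket (basis (GL m)) (\<psi> (basis (X n)))) i" for m n i
    using half_derivation_lookup[OF der X] by (simp add: L)
  have component: "Poly_Mapping.lookup (\<psi> (basis (X n))) (Y k) = 0"
    if Y: "\<And>m k y. Poly_Mapping.lookup (gca_bracket (basis (GL m)) y) (Y k)
        = of_int (m + \<mu> * m - k) * Poly_Mapping.lookup y (Y (k - m))"
    for Y :: "int \<Rightarrow> gca_index" and k \<mu>
  proof -
    define f where "f j = Poly_Mapping.lookup (\<psi> (basis (X j))) (Y (j + (k - n)))" for j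
    have "f n = 0"
    proof (rule module_recurrence_eq_0[OF _ \<open>0 \<le> \<kappa>\<close>])
      fix m j
      show "2 * of_int (\<kappa> * m - j) * f (m + j) = of_int (\<mu> * m - j - (k - n)) * f j"
        unfolding f_def rec Y by (simp add: algebra_simps)
    qed
    then show ?thesis by (simp add: f_def)
  qed
  have "Poly_Mapping.lookup (\<psi> (basis (X n))) i = 0"
  proof (cases i)
    case (GL k)
    then show ?thesis by (simp add: component[of GL 1] lookup_bracket_L)
  next
    case (GH k)
    then show ?thesis by (simp add: component[of GH 0] lookup_bracket_L)
  next
    case (GI k)
    then show ?thesis by (simp add: component[of GI 1] lookup_bracket_L)
  next
    case (GJ k)
    then show ?thesis by (simp add: component[of GJ 1] lookup_bracket_L)
  qed
  then show "Poly_Mapping.lookup (\<psi> (basis (X n))) i = Poly_Mapping.lookup 0 i"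
    by simp
qed

text \<open>
  By the Witt recurrence, \<open>\<psi>\<close> vanishes on all \<open>L\<^sub>m\<close> as soon as it vanishes on \<open>L\<^sub>0\<close>, since constants
  solve the recurrence for \<open>\<mu> = 1\<close> and its other solutions are determined by their value at \<open>0\<close>.
  The components of \<open>\<psi>(L\<^sub>0)\<close> along \<open>H\<close> are excluded by the relations among the \<open>L\<^sub>m\<close> themselves,
  those along \<open>I\<close>, \<open>J\<close> and \<open>L\<close> (except at \<open>L\<^sub>0\<close>, where the normalisation enters) by the brackets
  with \<open>H\<close>.
\<close>

lemma half_derivation_L_eq_0:
  assumes der: "half_derivation gca_scale gca_bracket \<psi>"
    and normalised: "Poly_Mapping.lookup (\<psi> (basis (GL 0))) (GL 0) = 0"
  shows "\<psi> (basis (GL m)) = 0"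
proof -
  define c where "c Y d m = Poly_Mapping.lookup (\<psi> (basis (GL m))) (Y (m + d))"
    for Y :: "int \<Rightarrow> gca_index" and d m
  have LL: "2 * of_int (m - n) * Poly_Mapping.lookup (\<psi> (basis (GL (m + n)))) i
      = Poly_Mapping.lookup (gca_bracket (basis (GL m)) (\<psi> (basis (GL n)))) i
        - Poly_Mapping.lookup (gca_bracket (basis (GL n)) (\<psi> (basis (GL m)))) i" for m n i
    using half_derivation_lookup[OF der, of "basis (GL m)" "basis (GL n)" "of_int (m - n)"
        "basis (GL (m + n))" i]
      gca_bracket_skew[of "\<psi> (basis (GL m))" "basis (GL n)"]
    by simp
  have LH: "- 2 * of_int n * Poly_Mapping.lookup (\<psi> (basis (GH (m + n)))) i
      = Poly_Mapping.lookup (gca_bracket (\<psi> (basis (GL m))) (basis (GH n))) i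
        + Poly_Mapping.lookup (gca_bracket (basis (GL m)) (\<psi> (basis (GH n)))) i" for m n i
    using half_derivation_lookup[OF der, of "basis (GL m)" "basis (GH n)" "of_int (- n)"
        "basis (GH (m + n))" i]
    by simp
  have rec: "2 * of_int (m - n) * c Y d (m + n)
      = of_int (d + m - n) * c Y d m + of_int (m - n - d) * c Y d n"
    if "Y \<in> {GL, GI, GJ}" for Y d m n
    using that LL[of m n "Y (m + n + d)"]
    by (auto simp: c_def lookup_bracket_L algebra_simps)
  have recH: "2 * of_int (m - n) * c GH d (m + n)
      = of_int (d + m) * c GH d m + of_int (- n - d) * c GH d n" for d m n
    using LL[of m n "GH (m + n + d)"]
    by (simp add: c_def lookup_bracket_L algebra_simps)
  have const: "c Y d m = c Y d 0" if "Y \<in> {GL, GI, GJ}" for Y d m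
  proof -
    have "c Y d m - c Y d 0 = 0"
      by (rule witt_recurrence_eq_0[where d = d and \<mu> = 1])
        (use rec[OF that] in \<open>simp_all add: algebra_simps\<close>)
    then show ?thesis by simp
  qed
  have H: "c GH d m = 0" for d m
  proof (rule witt_recurrence_eq_0[where d = d and \<mu> = 0])
    show "c GH d 0 = 0"
    proof (cases "d = 0")
      case True
      then show ?thesis using recH[of 1 "- 1" 0] recH[of 1 0 0] recH[of "- 1" 0 0] by simp
    qed (use recH[of d 0 d] in simp)
  qed (use recH in simp)
  have I: "c GI d m = 0" for d m
  proof -
    \<comment> \<open>A function constant in \<open>m\<close> and divisible by \<open>m - d\<close> vanishes.\<close>
    have "c GI d m = of_int (m - d) * Poly_Mapping.lookup (\<psi> (basis (GH 0))) (GJ d)" for m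
      using LH[of 0 m "GJ (m + d)"]
      by (simp add: c_def lookup_bracket_L lookup_bracket_H_right)
    from this[of d] show ?thesis using const[of GI d m] const[of GI d d] by simp
  qed
  have J: "c GJ d m = 0" for d m
  proof -
    have "0 = c GJ d m + of_int (m - d) * Poly_Mapping.lookup (\<psi> (basis (GH 0))) (GI d)" for m
      using LH[of 0 m "GI (m + d)"]
      by (simp add: c_def lookup_bracket_L lookup_bracket_H_right)
    from this[of d] show ?thesis using const[of GJ d m] const[of GJ d d] by simp
  qed
  have L: "c GL d m = 0" for d m
  proof (cases "d = 0")
    case True
    then show ?thesis using const[of GL d m] normalised by (simp add: c_def)
  next
    case False
    \<comment> \<open>At this coefficient the unknown \<open>\<psi>(H\<^sub>d)\<close> occurs with the same factor \<open>- 2 d\<close> on both sides.\<close>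
    have "c GL d 0 = 0"
      using LH[of d 0 "GH (2 * d)"] False
      by (simp add: c_def lookup_bracket_L lookup_bracket_H_right)
    then show ?thesis using const[of GL d m] by simp
  qed
  show ?thesis
  proof (rule poly_mapping_eqI)
    fix i
    show "Poly_Mapping.lookup (\<psi> (basis (GL m))) i = Poly_Mapping.lookup 0 i"
    proof (cases i)
      case (GL k) then show ?thesis using L[of "k - m" m] by (simp add: c_def)
    next
      case (GH k) then show ?thesis using H[of "k - m" m] by (simp add: c_def)
    next
      case (GI k) then show ?thesis using I[of "k - m" m] by (simp add: c_def)
    next
      case (GJ k) then show ?thesis using J[of "k - m" m] by (simp add: c_def)
    qed
  qed
qed

theorem mainTheorem1:
  fixes \<phi> :: "gca \<Rightarrow> gca"
  assumes "half_derivation gca_scale gca_bracket \<phi>"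
  shows "\<exists>a::complex. \<forall>x. \<phi> x = gca_scale a x"
proof -
  define a where "a = Poly_Mapping.lookup (\<phi> (basis (GL 0))) (GL 0)"
  define \<psi> where "\<psi> x = \<phi> x - gca_scale a x" for x
  have der: "half_derivation gca_scale gca_bracket \<psi>"
    unfolding \<psi>_def by (rule gca.half_derivation_minus_scale[OF assms])
  then interpret \<psi>: Vector_Spaces.linear gca_scale gca_scale \<psi>
    by (simp add: half_derivation_def)
  have L: "\<psi> (basis (GL m)) = 0" for m
    by (rule half_derivation_L_eq_0[OF der]) (simp add: \<psi>_def a_def lookup_minus)
  have "\<psi> (basis i) = 0" for i
  proof (cases i)
    case (GH n)
    then show ?thesis
      using half_derivation_family_eq_0[OF der L, of GH 0] by simp
  next
    case (GI n)
    then show ?thesis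
      using half_derivation_family_eq_0[OF der L, of GI 1] by simp
  next
    case (GJ n)
    then show ?thesis
      using half_derivation_family_eq_0[OF der L, of GJ 1] by simp
  qed (simp add: L)
  then have single: "\<psi> (Poly_Mapping.single i b) = 0" for i b
    using \<psi>.scale[of b "basis i"] by simp
  have "\<psi> x = 0" for x
    by (induction x rule: gca_induct) (simp_all add: single \<psi>.add \<psi>.zero)
  then show ?thesis by (auto simp: \<psi>_def)
qed

end
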